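(* Let $\mathfrak g$ be a Lie algebra, $V$ a vector space carrying a representation $(V;\rho)$ of $\mathfrak g$, and $d_1,d_2,d_3:\mathfrak g\to V$ linear maps. (1) $(d_1,d_2,d_3)$ is a hyper relative differential operator on $\mathfrak g$ with respect to $(V;\rho)$ if and only if there exist an invertible linear map $h^\flat:\mathfrak g\to V$ and complex structures $I_1,I_2:\mathfrak g\to\mathfrak g$ such that $I_1\circ I_2=-I_2\circ I_1$ and, with $I_3=I_1\circ I_2$, one has $d_i=h^\flat\circ I_i$ for $i=1,2,3$ and these maps are relative differential operators with respect to $(V;\rho)$. (2) $(d_1,d_2,d_3)$ is a para-hyper relative differential operator (with $\varepsilon=(1,1,-1)$) on $\mathfrak g$ with respect to $(V;\rho)$ if and only if there exist an invertible linear map $h^\flat:\mathfrak g\to V$ and para-complex structures $I_1,I_2:\mathfrak g\to\mathfrak g$ such that $I_1\circ I_2=-I_2\circ I_1$ and, with $I_3=I_1\circ I_2$, one has $d_i=h^\flat\circ I_i$ for $i=1,2,3$ and these maps are relative differential operators with respect to $(V;\rho)$.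
   Context: Everything is over a ground field $\mathbb K$ of characteristic different from $2$. Let $\mathfrak g$ be a Lie algebra and $\rho:\mathfrak g\to\mathfrak{gl}(V)$ a representation, denoted $(V;\rho)$. A relative differential operator (with respect to $(V;\rho)$) is a linear map $d:\mathfrak g\to V$ with $d[x,y]=\rho(x)d(y)-\rho(y)d(x)$ for all $x,y\in\mathfrak g$. Indices are in $\mathbb Z_3=\{1,2,3\}$ (mod 3). Let $d_1,d_2,d_3:\mathfrak g\to V$ be invertible relative differential operators with respect to $(V;\rho)$; set $T_i:=d_i^{-1}$ and $N_i:=T_{i-1}\circ d_{i+1}$. If $N_i^2=\varepsilon_i\,\mathrm{Id}_{\mathfrak g}$ with $\varepsilon_i\in\{1,-1\}$ for $i=1,2,3$, the triple $(d_1,d_2,d_3)$ is called an $\varepsilon=(\varepsilon_1,\varepsilon_2,\varepsilon_3)$-hyper relative differential operator. When $\varepsilon_1\varepsilon_2\varepsilon_3=-1$, it is called a hyper relative differential operator if $\varepsilon=(-1,-1,-1)$, and a para-hyper relative differential operator otherwise; by a cyclic permutation of the indices, para-hyper relative differential operators are always taken with $\varepsilon=(1,1,-1)$. A Nijenhuis operator on $\mathfrak g$ is a linear map $N:\mathfrak g\to\mathfrak g$ with $[N(x),N(y)]=N\big([N(x),y]+[x,N(y)]-N[x,y]\big)$ for all $x,y\in\mathfrak g$. A complex structure is a Nijenhuis operator with $N^2=-\mathrm{Id}_{\mathfrak g}$; a para-complex structure is a Nijenhuis operator with $N^2=\mathrm{Id}_{\mathfrak g}$. *)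

theory Defs
  imports Complex_Main "HOL-Library.Numeral_Type"
begin

locale lie_algebra = vector_space scale
  for scale :: "'k::field \<Rightarrow> 'g::ab_group_add \<Rightarrow> 'g" +
  fixes bracket :: "'g \<Rightarrow> 'g \<Rightarrow> 'g" (\<open>\<lbrakk>_,/ _\<rbrakk>\<close>)
  assumes linear_bracket_left: "Vector_Spaces.linear scale scale (\<lambda>x. \<lbrakk>x, y\<rbrakk>)"
    and linear_bracket_right: "Vector_Spaces.linear scale scale (\<lambda>y. \<lbrakk>x, y\<rbrakk>)"
    and bracket_self: "\<lbrakk>x, x\<rbrakk> = 0"
    and jacobi: "\<lbrakk>x, \<lbrakk>y, z\<rbrakk>\<rbrakk> + \<lbrakk>y, \<lbrakk>z, x\<rbrakk>\<rbrakk> + \<lbrakk>z, \<lbrakk>x, y\<rbrakk>\<rbrakk> = 0"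

locale lie_representation =
  lie_algebra scale bracket + V: vector_space scaleV
  for scale :: "'k::field \<Rightarrow> 'g::ab_group_add \<Rightarrow> 'g"
    and bracket :: "'g \<Rightarrow> 'g \<Rightarrow> 'g"
    and scaleV :: "'k \<Rightarrow> 'v::ab_group_add \<Rightarrow> 'v" +
  fixes \<rho> :: "'g \<Rightarrow> 'v \<Rightarrow> 'v"
  assumes linear_action: "Vector_Spaces.linear scaleV scaleV (\<rho> x)"
    and linear_rho: "Vector_Spaces.linear scale scaleV (\<lambda>x. \<rho> x v)"
    and rho_bracket: "\<rho> (bracket x y) v = \<rho> x (\<rho> y v) - \<rho> y (\<rho> x v)"

definition relative_differential_operator ::
  "('k::field \<Rightarrow> 'g::ab_group_add \<Rightarrow> 'g) \<Rightarrow> ('g \<Rightarrow> 'g \<Rightarrow> 'g) \<Rightarrow> ('k \<Rightarrow> 'v::ab_group_add \<Rightarrow> 'v) \<Rightarrow>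
   ('g \<Rightarrow> 'v \<Rightarrow> 'v) \<Rightarrow> ('g \<Rightarrow> 'v) \<Rightarrow> bool" where
  "relative_differential_operator scale bracket scaleV \<rho> d \<longleftrightarrow>
     Vector_Spaces.linear scale scaleV d \<and>
     (\<forall>x y. d (bracket x y) = \<rho> x (d y) - \<rho> y (d x))"

text \<open>
  The indices in the integers modulo 3 are the elements of the numeral type \<^typ>\<open>3\<close>, on which
  \<open>3 = 0\<close> and \<open>+\<close>, \<open>-\<close> are taken modulo 3; a triple indexed by \<open>1, 2, 3\<close> is a function on that type.
\<close>

definition triple :: "'a \<Rightarrow> 'a \<Rightarrow> 'a \<Rightarrow> 3 \<Rightarrow> 'a" where
  "triple a b c i = (if i = 1 then a else if i = 2 then b else c)"

definition transition :: "(3 \<Rightarrow> 'g \<Rightarrow> 'v) \<Rightarrow> 3 \<Rightarrow> 'g \<Rightarrow> 'g" where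
  "transition d i = inv (d (i - 1)) \<circ> d (i + 1)"

definition eps_hyper_relative_differential_operator ::
  "(3 \<Rightarrow> 'k) \<Rightarrow> ('k::field \<Rightarrow> 'g::ab_group_add \<Rightarrow> 'g) \<Rightarrow> ('g \<Rightarrow> 'g \<Rightarrow> 'g) \<Rightarrow>
   ('k \<Rightarrow> 'v::ab_group_add \<Rightarrow> 'v) \<Rightarrow> ('g \<Rightarrow> 'v \<Rightarrow> 'v) \<Rightarrow> (3 \<Rightarrow> 'g \<Rightarrow> 'v) \<Rightarrow> bool" where
  "eps_hyper_relative_differential_operator \<epsilon> scale bracket scaleV \<rho> d \<longleftrightarrow>
     (\<forall>i. relative_differential_operator scale bracket scaleV \<rho> (d i) \<and> bij (d i)) \<and>
     (\<forall>i. \<epsilon> i \<in> {1, - 1}) \<and>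
     (\<forall>i x. transition d i (transition d i x) = scale (\<epsilon> i) x)"

definition hyper_relative_differential_operator ::
  "('k::field \<Rightarrow> 'g::ab_group_add \<Rightarrow> 'g) \<Rightarrow> ('g \<Rightarrow> 'g \<Rightarrow> 'g) \<Rightarrow>
   ('k \<Rightarrow> 'v::ab_group_add \<Rightarrow> 'v) \<Rightarrow> ('g \<Rightarrow> 'v \<Rightarrow> 'v) \<Rightarrow> (3 \<Rightarrow> 'g \<Rightarrow> 'v) \<Rightarrow> bool" where
  "hyper_relative_differential_operator =
     eps_hyper_relative_differential_operator (triple (- 1) (- 1) (- 1))"

text \<open>
  The sign triples with product \<open>-1\<close> other than \<open>(-1, -1, -1)\<close> are the cyclic permutations of
  \<open>(1, 1, -1)\<close>; para-hyper operators are normalised to that representative.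
\<close>

definition para_hyper_relative_differential_operator ::
  "('k::field \<Rightarrow> 'g::ab_group_add \<Rightarrow> 'g) \<Rightarrow> ('g \<Rightarrow> 'g \<Rightarrow> 'g) \<Rightarrow>
   ('k \<Rightarrow> 'v::ab_group_add \<Rightarrow> 'v) \<Rightarrow> ('g \<Rightarrow> 'v \<Rightarrow> 'v) \<Rightarrow> (3 \<Rightarrow> 'g \<Rightarrow> 'v) \<Rightarrow> bool" where
  "para_hyper_relative_differential_operator =
     eps_hyper_relative_differential_operator (triple 1 1 (- 1))"

definition nijenhuis_operator ::
  "('k::field \<Rightarrow> 'g::ab_group_add \<Rightarrow> 'g) \<Rightarrow> ('g \<Rightarrow> 'g \<Rightarrow> 'g) \<Rightarrow> ('g \<Rightarrow> 'g) \<Rightarrow> bool" where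
  "nijenhuis_operator scale bracket N \<longleftrightarrow>
     Vector_Spaces.linear scale scale N \<and>
     (\<forall>x y. bracket (N x) (N y) = N (bracket (N x) y + bracket x (N y) - N (bracket x y)))"

definition complex_structure ::
  "('k::field \<Rightarrow> 'g::ab_group_add \<Rightarrow> 'g) \<Rightarrow> ('g \<Rightarrow> 'g \<Rightarrow> 'g) \<Rightarrow> ('g \<Rightarrow> 'g) \<Rightarrow> bool" where
  "complex_structure scale bracket J \<longleftrightarrow>
     nijenhuis_operator scale bracket J \<and> (\<forall>x. J (J x) = - x)"

definition para_complex_structure ::
  "('k::field \<Rightarrow> 'g::ab_group_add \<Rightarrow> 'g) \<Rightarrow> ('g \<Rightarrow> 'g \<Rightarrow> 'g) \<Rightarrow> ('g \<Rightarrow> 'g) \<Rightarrow> bool" where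
  "para_complex_structure scale bracket J \<longleftrightarrow>
     nijenhuis_operator scale bracket J \<and> (\<forall>x. J (J x) = x)"

end

theory Submission
  imports Defs "HOL-Analysis.Cartesian_Space"
begin

text \<open>
  Both parts are one statement for a sign \<open>s\<close> (\<open>s = -1\<close> hyper, \<open>s = 1\<close> para-hyper): the triple is a
  \<open>(s, s, -1)\<close>-hyper relative differential operator iff \<open>d\<^sub>i = h \<circ> I\<^sub>i\<close> with Nijenhuis \<open>I\<^sub>1, I\<^sub>2\<close>
  of square \<open>s\<close> that anticommute and \<open>I\<^sub>3 = I\<^sub>1 I\<^sub>2\<close>.

  Two facts about the transition maps \<open>N\<^sub>i = d\<^sub>i\<^sub>-\<^sub>1\<inverse> d\<^sub>i\<^sub>+\<^sub>1\<close> carry the forward direction. First, if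
  \<open>d\<close> and \<open>d \<circ> N\<close> are relative differential operators with \<open>d\<close> injective and \<open>N\<^sup>2\<close> a scalar, then
  \<open>N\<close> is Nijenhuis (\<open>nijenhuis_of_relative_differential_operators\<close>); since
  \<open>d\<^sub>i\<^sub>-\<^sub>1 \<circ> N\<^sub>i = d\<^sub>i\<^sub>+\<^sub>1\<close>, this covers every \<open>N\<^sub>i\<close>. Secondly, the product of two consecutive
  transition maps telescopes to the inverse of the third (\<open>transition_product\<close>), so
  \<open>N\<^sub>i\<^sub>-\<^sub>1 N\<^sub>i\<^sub>+\<^sub>1 = \<epsilon>\<^sub>i N\<^sub>i\<close>. As the product of the signs is \<open>-1\<close>, the \<open>N\<^sub>i\<close> multiply like the
  (split) quaternion units up to sign, and \<open>I\<^sub>1 = -s N\<^sub>1\<close>, \<open>I\<^sub>2 = N\<^sub>2\<close>, \<open>h = - d\<^sub>1 N\<^sub>1\<close> solve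
  the equations \<open>d\<^sub>i = h I\<^sub>i\<close>.

  Conversely, \<open>d\<^sub>i = h I\<^sub>i\<close> forces \<open>N\<^sub>1 = -s I\<^sub>1\<close>, \<open>N\<^sub>2 = I\<^sub>2\<close> and \<open>N\<^sub>3 = -s I\<^sub>1 I\<^sub>2\<close>, whose squares
  are \<open>s\<close>, \<open>s\<close> and \<open>-s\<^sup>2 = -1\<close>.
\<close>

lemma linear_lift_of_inj:
  assumes d: "Vector_Spaces.linear s1 s2 d" and "inj d"
    and dN: "Vector_Spaces.linear s3 s2 (d \<circ> N)"
  shows "Vector_Spaces.linear s3 s1 N"
proof -
  interpret d: Vector_Spaces.linear s1 s2 d by (fact d)
  interpret dN: Vector_Spaces.linear s3 s2 "d \<circ> N" by (fact dN)
  have "N (x + y) = N x + N y" for x y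
    using dN.add[of x y] by (intro injD[OF \<open>inj d\<close>]) (simp add: d.add)
  moreover have "N (s3 c x) = s1 c (N x)" for c x
    using dN.scale[of c x] by (intro injD[OF \<open>inj d\<close>]) (simp add: d.scale)
  ultimately show ?thesis
    by unfold_locales auto
qed

lemma (in lie_algebra) nijenhuis_operator_scale:
  assumes "nijenhuis_operator scale bracket N"
  shows "nijenhuis_operator scale bracket (\<lambda>x. scale c (N x))"
proof -
  have N: "Vector_Spaces.linear scale scale N"
    and nij: "\<And>x y. \<lbrakk>N x, N y\<rbrakk> = N (\<lbrakk>N x, y\<rbrakk> + \<lbrakk>x, N y\<rbrakk> - N \<lbrakk>x, y\<rbrakk>)"
    using assms by (auto simp: nijenhuis_operator_def)
  interpret N: Vector_Spaces.linear scale scale N by (fact N)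
  have left: "\<lbrakk>scale c x, y\<rbrakk> = scale c \<lbrakk>x, y\<rbrakk>" for x y
    using linear_bracket_left[of y] by (simp add: module_hom_iff flip: module_hom_iff_linear)
  have right: "\<lbrakk>x, scale c y\<rbrakk> = scale c \<lbrakk>x, y\<rbrakk>" for x y
    using linear_bracket_right[of x] by (simp add: module_hom_iff flip: module_hom_iff_linear)
  have "Vector_Spaces.linear scale scale (\<lambda>x. scale c (N x))"
    by unfold_locales (simp_all add: N.add N.scale scale_right_distrib scale_left_commute)
  moreover have "\<lbrakk>scale c (N x), scale c (N y)\<rbrakk> =
      scale c (N (\<lbrakk>scale c (N x), y\<rbrakk> + \<lbrakk>x, scale c (N y)\<rbrakk> - scale c (N \<lbrakk>x, y\<rbrakk>)))" for x y
    by (simp add: left right nij N.scale flip: scale_right_distrib scale_right_diff_distrib)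
  ultimately show ?thesis
    by (auto simp: nijenhuis_operator_def)
qed

context lie_representation
begin

text \<open>
  Expanding \<open>d (N [N x, y])\<close> and \<open>d (N [x, N y])\<close> by the rule for \<open>d \<circ> N\<close> and using \<open>N\<^sup>2 = c\<close>
  gives four terms, which the rule for \<open>d\<close> regroups into \<open>d [N x, N y] + c d [x, y]\<close>; the last
  summand is \<open>d (N\<^sup>2 [x, y])\<close>, and \<open>d\<close> can be cancelled.
\<close>
lemma nijenhuis_of_relative_differential_operators:
  assumes d: "relative_differential_operator scale bracket scaleV \<rho> d" and "inj d"
    and dN: "relative_differential_operator scale bracket scaleV \<rho> (d \<circ> N)"
    and sq: "\<And>x. N (N x) = scale c x"
  shows "nijenhuis_operator scale bracket N"
proof -
  have lin_d: "Vector_Spaces.linear scale scaleV d"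
    and der_d: "\<And>x y. d (bracket x y) = \<rho> x (d y) - \<rho> y (d x)"
    using d by (auto simp: relative_differential_operator_def)
  have lin_dN: "Vector_Spaces.linear scale scaleV (d \<circ> N)"
    and der_dN: "\<And>x y. d (N (bracket x y)) = \<rho> x (d (N y)) - \<rho> y (d (N x))"
    using dN by (auto simp: relative_differential_operator_def)
  have lin_N: "Vector_Spaces.linear scale scale N"
    using lin_d \<open>inj d\<close> lin_dN by (rule linear_lift_of_inj)
  interpret d: Vector_Spaces.linear scale scaleV d by (fact lin_d)
  interpret N: Vector_Spaces.linear scale scale N by (fact lin_N)
  have act: "\<rho> x (scaleV c v) = scaleV c (\<rho> x v)" for x v
    using linear_action[of x] by (simp add: module_hom_iff flip: module_hom_iff_linear)
  have "bracket (N x) (N y) = N (bracket (N x) y + bracket x (N y) - N (bracket x y))" for x y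
  proof (rule injD[OF \<open>inj d\<close>])
    have "d (N (bracket (N x) y + bracket x (N y) - N (bracket x y)))
        = d (N (bracket (N x) y)) + d (N (bracket x (N y))) - scaleV c (d (bracket x y))"
      by (simp add: N.add N.diff d.add d.diff d.scale sq)
    also have "\<dots> = d (bracket (N x) (N y))"
      by (simp add: der_d der_dN sq d.scale act V.scale_right_diff_distrib algebra_simps)
    finally show "d (bracket (N x) (N y)) = d (N (bracket (N x) y + bracket x (N y) - N (bracket x y)))" ..
  qed
  with lin_N show ?thesis
    by (auto simp: nijenhuis_operator_def)
qed

end

lemma comp_transition:
  assumes "surj (d (i - 1))"
  shows "d (i - 1) (transition d i x) = d (i + 1) x"
  using assms by (simp add: transition_def surj_f_inv_f)

lemma transition_eqI:
  assumes "inj (d (i - 1))" "\<And>x. d (i - 1) (M x) = d (i + 1) x"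
  shows "transition d i = M"
  using assms by (auto simp: transition_def fun_eq_iff intro!: inv_f_eq)

text \<open>
  In \<open>N\<^sub>i\<^sub>-\<^sub>1 N\<^sub>i\<^sub>+\<^sub>1 = d\<^sub>i\<^sub>-\<^sub>2\<inverse> d\<^sub>i d\<^sub>i\<inverse> d\<^sub>i\<^sub>+\<^sub>2\<close> the middle factors cancel, and modulo 3 what is left
  is \<open>d\<^sub>i\<^sub>+\<^sub>1\<inverse> d\<^sub>i\<^sub>-\<^sub>1 = N\<^sub>i\<inverse>\<close>.
\<close>
lemma transition_product:
  fixes d :: "3 \<Rightarrow> 'g \<Rightarrow> 'v"
  assumes bij: "\<And>i. bij (d i)"
  shows "transition d i (transition d (i - 1) (transition d (i + 1) x)) = x"
proof -
  have idx: "i - 1 - 1 = i + 1" "i + 1 - 1 = i" "i + 1 + 1 = i - 1"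
    using forall_3[of "\<lambda>i. i - 1 - 1 = i + 1 \<and> i + 1 + 1 = i - 1"] by simp_all
  have inj: "inj (d j)" and surj: "surj (d j)" for j
    using bij by (auto simp: bij_def)
  have "d (i - 1) (transition d i (transition d (i - 1) (transition d (i + 1) x)))
      = d (i + 1) (transition d (i - 1) (transition d (i + 1) x))"
    by (simp add: comp_transition surj)
  also have "\<dots> = d i (transition d (i + 1) x)"
    using comp_transition[of d "i - 1", OF surj] by (simp add: idx)
  also have "\<dots> = d (i - 1) x"
    using comp_transition[of d "i + 1", OF surj] by (simp add: idx)
  finally show ?thesis
    by (rule injD[OF inj])
qed

context lie_representation
begin

text \<open>
  Keeping the sign \<open>s\<close> as a parameter lets the hyper and the para-hyper case share one proof.
\<close>
lemma eps_hyper_iff_anticommuting_nijenhuis: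
  assumes s: "s = 1 \<or> s = - 1" and lin: "\<And>i. Vector_Spaces.linear scale scaleV (d i)"
  shows "eps_hyper_relative_differential_operator (triple s s (- 1)) scale bracket scaleV \<rho> d \<longleftrightarrow>
    (\<exists>h I. Vector_Spaces.linear scale scaleV h \<and> bij h \<and>
      (nijenhuis_operator scale bracket (I 1) \<and> (\<forall>x. I 1 (I 1 x) = scale s x)) \<and>
      (nijenhuis_operator scale bracket (I 2) \<and> (\<forall>x. I 2 (I 2 x) = scale s x)) \<and>
      (\<forall>x. (I 1 \<circ> I 2) x = - (I 2 \<circ> I 1) x) \<and> I 3 = I 1 \<circ> I 2 \<and>
      (\<forall>i::3. d i = h \<circ> I i \<and> relative_differential_operator scale bracket scaleV \<rho> (d i)))"
    (is "?hyper \<longleftrightarrow> (\<exists>h I. ?structure h I)")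
proof -
  have ss: "s * s = 1"
    using s by auto
  note V.scale_minus_left [simp] V.scale_minus_right [simp]
  \<comment> \<open>Index arithmetic such as \<open>3 + 1\<close> and \<open>1 - 1\<close> is evaluated on numerals but not reduced to
    the representatives \<open>1, 2, 3\<close>.\<close>
  have Z3: "(4::3) = 1" "(0::3) = 3"
    by simp_all
  have triple_simps: "triple s s (- 1) 1 = s" "triple s s (- 1) 2 = s" "triple s s (- 1) 3 = - 1"
    by (simp_all add: triple_def)
  show ?thesis
  proof
    assume hyper: ?hyper
    then have rdo: "\<And>i. relative_differential_operator scale bracket scaleV \<rho> (d i)"
      and bij: "\<And>i. bij (d i)"
      and sq: "\<And>i x. transition d i (transition d i x) = scale (triple s s (- 1) i) x"
      by (auto simp: eps_hyper_relative_differential_operator_def)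
    have comp: "d (i - 1) \<circ> transition d i = d (i + 1)" for i
      using bij by (auto simp: fun_eq_iff bij_def intro!: comp_transition)
    have nij: "nijenhuis_operator scale bracket (transition d i)" for i
      by (rule nijenhuis_of_relative_differential_operators[OF rdo[of "i - 1"]])
         (use bij rdo sq in \<open>auto simp: bij_def comp\<close>)
    then have lin_N: "Vector_Spaces.linear scale scale (transition d i)" for i
      by (auto simp: nijenhuis_operator_def)
    define N1 N2 N3 where "N1 = transition d 1" and "N2 = transition d 2" and "N3 = transition d 3"
    note N_defs = N1_def N2_def N3_def
    interpret N1: Vector_Spaces.linear scale scale N1 unfolding N_defs by (rule lin_N)
    interpret N2: Vector_Spaces.linear scale scale N2 unfolding N_defs by (rule lin_N)
    interpret d1: Vector_Spaces.linear scale scaleV "d 1" by (rule lin)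
    interpret d2: Vector_Spaces.linear scale scaleV "d 2" by (rule lin)
    have sq1: "N1 (N1 x) = scale s x" and sq2: "N2 (N2 x) = scale s x" and sq3: "N3 (N3 x) = - x" for x
      using sq[of 1 x] sq[of 2 x] sq[of 3 x] by (simp_all add: N_defs triple_simps)
    have d1_N2: "d 1 (N2 x) = d 3 x" and d2_N3: "d 2 (N3 x) = d 1 x" for x
      using fun_cong[OF comp[of 2], of x] fun_cong[OF comp[of 3], of x] by (simp_all add: N_defs Z3)
    have N3_N2_N1: "N3 (N2 (N1 x)) = x" for x
      using transition_product[of d 3 x, OF bij] by (simp add: N_defs Z3)
    \<comment> \<open>The third sign \<open>-1\<close> enters here: it makes \<open>N\<^sub>2 N\<^sub>1 = N\<^sub>3\<inverse> = - N\<^sub>3\<close>, whereas the two equal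
      signs \<open>s\<close> cancel in \<open>N\<^sub>1 N\<^sub>2 = N\<^sub>3\<close>, so that \<open>N\<^sub>1\<close> and \<open>N\<^sub>2\<close> anticommute.\<close>
    have N21: "N2 (N1 x) = - N3 x" for x
      using sq3[of "N2 (N1 x)"] by (simp add: N3_N2_N1)
    have N12: "N1 (N2 x) = N3 x" for x
    proof -
      have "N1 (N2 x) = N3 (N2 (N1 (N1 (N2 x))))"
        by (simp add: N3_N2_N1)
      also have "\<dots> = N3 x"
        by (simp add: sq1 sq2 ss N2.scale)
      finally show ?thesis .
    qed
    \<comment> \<open>The equations \<open>d\<^sub>i = h I\<^sub>i\<close> force \<open>I\<^sub>2 = d\<^sub>1\<inverse> d\<^sub>3 = N\<^sub>2\<close> and
      \<open>N\<^sub>1 = d\<^sub>3\<inverse> d\<^sub>2 = I\<^sub>2\<inverse> I\<^sub>1\<inverse> I\<^sub>2 = - I\<^sub>1\<inverse> = - s I\<^sub>1\<close>, hence \<open>I\<^sub>1 = - s N\<^sub>1\<close> as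
      \<open>s\<^sup>2 = 1\<close>, and \<open>h = d\<^sub>1 I\<^sub>1\<inverse> = - d\<^sub>1 N\<^sub>1\<close>.\<close>
    define h where "h = (\<lambda>x. - d 1 (N1 x))"
    define I where "I = triple (\<lambda>x. scale (- s) (N1 x)) N2 (\<lambda>x. scale (- s) (N1 (N2 x)))"
    have I_simps: "I 1 = (\<lambda>x. scale (- s) (N1 x))" "I 2 = N2" "I 3 = I 1 \<circ> I 2"
      by (simp_all add: I_def triple_def fun_eq_iff)
    have "Vector_Spaces.linear scale scaleV h"
      unfolding h_def by unfold_locales
        (simp_all add: N1.add N1.scale d1.add d1.scale)
    moreover have "bij h"
    proof -
      have "bij N1"
        by (rule bij_betw_byWitness[where f' = "\<lambda>x. scale s (N1 x)"])
           (auto simp: sq1 N1.scale ss)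
      then have "bij (uminus \<circ> (d 1 \<circ> N1))"
        using bij by (intro bij_comp) (auto simp: bij_uminus)
      then show ?thesis
        by (simp add: h_def comp_def)
    qed
    moreover have "nijenhuis_operator scale bracket (I 1)" "nijenhuis_operator scale bracket (I 2)"
      unfolding I_simps N_defs by (intro nijenhuis_operator_scale nij) (rule nij)
    moreover have "\<forall>x. I 1 (I 1 x) = scale s x" "\<forall>x. I 2 (I 2 x) = scale s x"
      by (simp_all add: I_simps sq1 sq2 N1.scale N1.neg ss)
    moreover have "\<forall>x. (I 1 \<circ> I 2) x = - (I 2 \<circ> I 1) x"
      by (simp add: I_simps N2.scale N2.neg N12 N21)
    moreover have "\<forall>i. d i = h \<circ> I i \<and> relative_differential_operator scale bracket scaleV \<rho> (d i)"
    proof -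
      have h1: "h (I 1 x) = d 1 x" for x
        by (simp add: h_def I_simps N1.scale N1.neg sq1 ss d1.neg)
      moreover have "h (I 2 x) = d 2 x" for x
        using d2_N3[of "N3 x", symmetric] by (simp add: h_def I_simps N12 sq3 d2.neg)
      moreover have "h (I 3 x) = d 3 x" for x
        by (simp add: I_simps(3) h1) (simp add: I_simps d1_N2)
      ultimately show ?thesis
        using rdo unfolding forall_3 fun_eq_iff comp_def by auto
    qed
    moreover note I_simps(3)
    ultimately have "?structure h I"
      by blast
    then show "\<exists>h I. ?structure h I"
      by blast
  next
    assume "\<exists>h I. ?structure h I"
    then obtain h and I where "?structure h I"
      by blast
    then have h: "Vector_Spaces.linear scale scaleV h" "bij h"
      and nij1: "nijenhuis_operator scale bracket (I 1)" and sq1: "\<And>x. I 1 (I 1 x) = scale s x"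
      and nij2: "nijenhuis_operator scale bracket (I 2)" and sq2: "\<And>x. I 2 (I 2 x) = scale s x"
      and anti: "\<And>x. I 1 (I 2 x) = - I 2 (I 1 x)" and I3: "I 3 = I 1 \<circ> I 2"
      and d: "\<And>i. d i = h \<circ> I i"
      and rdo: "\<And>i. relative_differential_operator scale bracket scaleV \<rho> (d i)"
      by (unfold comp_def) blast+
    interpret I1: Vector_Spaces.linear scale scale "I 1"
      using nij1 by (simp add: nijenhuis_operator_def)
    interpret I2: Vector_Spaces.linear scale scale "I 2"
      using nij2 by (simp add: nijenhuis_operator_def)
    have bij1: "bij (I 1)"
      by (rule bij_betw_byWitness[where f' = "\<lambda>x. scale s (I 1 x)"]) (auto simp: sq1 I1.scale ss)
    have bij2: "bij (I 2)"
      by (rule bij_betw_byWitness[where f' = "\<lambda>x. scale s (I 2 x)"]) (auto simp: sq2 I2.scale ss)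
    have "\<forall>i. bij (I i)"
      using bij1 bij2 by (simp add: forall_3 I3 bij_comp)
    with h have bij: "bij (d i)" for i
      by (simp add: d bij_comp)
    have inj: "inj (d i)" for i
      using bij by (simp add: bij_def)
    have N1: "transition d 1 = (\<lambda>x. scale (- s) (I 1 x))"
      and N2: "transition d 2 = I 2"
      and N3: "transition d 3 = (\<lambda>x. scale (- s) (I 1 (I 2 x)))"
      by (rule transition_eqI[OF inj];
          simp add: Z3 d I3 sq1 sq2 anti I1.scale I1.neg I2.scale I2.neg ss)+
    have "\<forall>i x. transition d i (transition d i x) = scale (triple s s (- 1) i) x"
      unfolding forall_3
      by (simp add: N1 N2 N3 triple_simps sq1 sq2 anti I1.scale I1.neg I2.scale I2.neg ss)
    moreover have "\<forall>i. triple s s (- 1) i \<in> {1, - 1}"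
      using s by (auto simp: triple_def)
    ultimately show ?hyper
      using rdo bij by (simp add: eps_hyper_relative_differential_operator_def)
  qed
qed

end

theorem theorem4p8:
  fixes scale :: "'k::field \<Rightarrow> 'g::ab_group_add \<Rightarrow> 'g"
    and bracket :: "'g \<Rightarrow> 'g \<Rightarrow> 'g"
    and scaleV :: "'k \<Rightarrow> 'v::ab_group_add \<Rightarrow> 'v"
    and \<rho> :: "'g \<Rightarrow> 'v \<Rightarrow> 'v"
    and d :: "3 \<Rightarrow> 'g \<Rightarrow> 'v"
  assumes "CHAR('k) \<noteq> 2"
    and "lie_representation scale bracket scaleV \<rho>"
    and "\<And>i. Vector_Spaces.linear scale scaleV (d i)"
  shows
    "(hyper_relative_differential_operator scale bracket scaleV \<rho> d \<longleftrightarrow>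
       (\<exists>h I. Vector_Spaces.linear scale scaleV h \<and> bij h \<and>
          complex_structure scale bracket (I 1) \<and> complex_structure scale bracket (I 2) \<and>
          (\<forall>x. (I 1 \<circ> I 2) x = - (I 2 \<circ> I 1) x) \<and> I 3 = I 1 \<circ> I 2 \<and>
          (\<forall>i::3. d i = h \<circ> I i \<and> relative_differential_operator scale bracket scaleV \<rho> (d i)))) \<and>
     (para_hyper_relative_differential_operator scale bracket scaleV \<rho> d \<longleftrightarrow>
       (\<exists>h I. Vector_Spaces.linear scale scaleV h \<and> bij h \<and>
          para_complex_structure scale bracket (I 1) \<and> para_complex_structure scale bracket (I 2) \<and>
          (\<forall>x. (I 1 \<circ> I 2) x = - (I 2 \<circ> I 1) x) \<and> I 3 = I 1 \<circ> I 2 \<and>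
          (\<forall>i::3. d i = h \<circ> I i \<and> relative_differential_operator scale bracket scaleV \<rho> (d i))))"
proof -
  interpret lie_representation scale bracket scaleV \<rho> by (fact assms(2))
  show ?thesis
    using eps_hyper_iff_anticommuting_nijenhuis[of "- 1" d, OF _ assms(3)]
      eps_hyper_iff_anticommuting_nijenhuis[of 1 d, OF _ assms(3)]
    by (simp add: hyper_relative_differential_operator_def
        para_hyper_relative_differential_operator_def complex_structure_def para_complex_structure_def)
qed

end
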